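(* Let $\mathbb{K}$ be a field of characteristic $0$ and let $\mathcal{P}=\mathcal{P}_0\oplus\mathcal{P}_1$ be a $\mathbb{K}$-super vector space. (i) Suppose $(\mathcal{P},\cdot,\{\,,\})$ is a Poisson superalgebra. Define a bilinear product on $\mathcal{P}$ by $xy=x\cdot y+\{x,y\}$. Then, for all homogeneous $x,y,z\in\mathcal{P}$, $$3(xy)z-3x(yz)+(-1)^{|x||y|}(yx)z-(-1)^{|y||z|}(xz)y-(-1)^{|x||y|+|x||z|}(yz)x+(-1)^{|x||z|+|y||z|}(zx)y=0. \qquad (\ast)$$ (ii) Conversely, suppose $xy$ is an even bilinear product on $\mathcal{P}$ (i.e. $\mathcal{P}_i\mathcal{P}_j\subseteq\mathcal{P}_{i+j \bmod 2}$) satisfying $(\ast)$ for all homogeneous $x,y,z$. Extend the following formulas bilinearly from homogeneous $x,y$: $$x\cdot y=\tfrac12\big(xy+(-1)^{|x||y|}yx\big),\qquad \{x,y\}=\tfrac12\big(xy-(-1)^{|x||y|}yx\big).$$ Then $(\mathcal{P},\cdot,\{\,,\})$ is a Poisson superalgebra, and $xy=x\cdot y+\{x,y\}$. In particular, $\mathcal{P}$ admits a Poisson superalgebra structure if and only if it admits an even bilinear product satisfying $(\ast)$.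
   Context: A $\mathbb{K}$-super vector space is a $\mathbb{Z}_2$-graded vector space $\mathcal{P}=\mathcal{P}_0\oplus\mathcal{P}_1$; elements of $\mathcal{P}_0$ (resp. $\mathcal{P}_1$) are homogeneous of degree $0$ (resp. $1$), and $|x|$ denotes the degree of a homogeneous element $x$. All bilinear products considered are even (they map $\mathcal{P}_i\times\mathcal{P}_j$ into $\mathcal{P}_{i+j \bmod 2}$). A Poisson superalgebra is a super vector space $\mathcal{P}$ with two even bilinear products $x\cdot y$ and $\{x,y\}$ such that: (1) $(\mathcal{P},\cdot)$ is associative and supercommutative: $x\cdot y=(-1)^{|x||y|}y\cdot x$; (2) $(\mathcal{P},\{\,,\})$ is a Lie superalgebra: $\{x,y\}=-(-1)^{|x||y|}\{y,x\}$ and $(-1)^{|z||x|}\{x,\{y,z\}\}+(-1)^{|x||y|}\{y,\{z,x\}\}+(-1)^{|y||z|}\{z,\{x,y\}\}=0$; (3) super Leibniz rule: $\{x,y\cdot z\}=\{x,y\}\cdot z+(-1)^{|x||y|}y\cdot\{x,z\}$; all for homogeneous $x,y,z$. *)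

theory Defs
  imports Complex_Main
begin

definition is_subspace :: "('k::field \<Rightarrow> 'v::ab_group_add \<Rightarrow> 'v) \<Rightarrow> 'v set \<Rightarrow> bool" where
  "is_subspace sc S \<longleftrightarrow> 0 \<in> S \<and> (\<forall>x\<in>S. \<forall>y\<in>S. x + y \<in> S) \<and> (\<forall>c. \<forall>x\<in>S. sc c x \<in> S)"

definition super_vs :: "('k::field \<Rightarrow> 'v::ab_group_add \<Rightarrow> 'v) \<Rightarrow> 'v set \<Rightarrow> 'v set \<Rightarrow> bool" where
  "super_vs sc P0 P1 \<longleftrightarrow> vector_space sc \<and> is_subspace sc P0 \<and> is_subspace sc P1
     \<and> P0 \<inter> P1 = {0} \<and> (\<forall>v. \<exists>a\<in>P0. \<exists>b\<in>P1. v = a + b)"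

definition part :: "'v set \<Rightarrow> 'v set \<Rightarrow> nat \<Rightarrow> 'v set" where
  "part P0 P1 i = (if i = 0 then P0 else P1)"

definition proj :: "'v::ab_group_add set \<Rightarrow> 'v set \<Rightarrow> nat \<Rightarrow> 'v \<Rightarrow> 'v" where
  "proj P0 P1 i v = (THE a. a \<in> part P0 P1 i \<and> v - a \<in> part P0 P1 (1 - i))"

definition bilinear_prod :: "('k::field \<Rightarrow> 'v::ab_group_add \<Rightarrow> 'v) \<Rightarrow> ('v \<Rightarrow> 'v \<Rightarrow> 'v) \<Rightarrow> bool" where
  "bilinear_prod sc f \<longleftrightarrow>
     (\<forall>x y z. f (x + y) z = f x z + f y z) \<and> (\<forall>x y z. f x (y + z) = f x y + f x z) \<and>
     (\<forall>c x y. f (sc c x) y = sc c (f x y)) \<and> (\<forall>c x y. f x (sc c y) = sc c (f x y))"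

definition even_prod :: "'v set \<Rightarrow> 'v set \<Rightarrow> ('v \<Rightarrow> 'v \<Rightarrow> 'v) \<Rightarrow> bool" where
  "even_prod P0 P1 f \<longleftrightarrow> (\<forall>i<2. \<forall>j<2. \<forall>x\<in>part P0 P1 i. \<forall>y\<in>part P0 P1 j.
      f x y \<in> part P0 P1 ((i + j) mod 2))"

definition poisson_superalgebra ::
  "('k::field \<Rightarrow> 'v::ab_group_add \<Rightarrow> 'v) \<Rightarrow> 'v set \<Rightarrow> 'v set \<Rightarrow> ('v \<Rightarrow> 'v \<Rightarrow> 'v) \<Rightarrow> ('v \<Rightarrow> 'v \<Rightarrow> 'v) \<Rightarrow> bool" where
  "poisson_superalgebra sc P0 P1 dot br \<longleftrightarrow>
     bilinear_prod sc dot \<and> bilinear_prod sc br \<and> even_prod P0 P1 dot \<and> even_prod P0 P1 br \<and>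
     (\<forall>i<2. \<forall>j<2. \<forall>k<2. \<forall>x\<in>part P0 P1 i. \<forall>y\<in>part P0 P1 j. \<forall>z\<in>part P0 P1 k.
        dot (dot x y) z = dot x (dot y z) \<and>
        dot x y = sc ((-1) ^ (i * j)) (dot y x) \<and>
        br x y = - sc ((-1) ^ (i * j)) (br y x) \<and>
        sc ((-1) ^ (k * i)) (br x (br y z)) + sc ((-1) ^ (i * j)) (br y (br z x))
          + sc ((-1) ^ (j * k)) (br z (br x y)) = 0 \<and>
        br x (dot y z) = dot (br x y) z + sc ((-1) ^ (i * j)) (dot y (br x z)))"

definition star_identity ::
  "('k::field \<Rightarrow> 'v::ab_group_add \<Rightarrow> 'v) \<Rightarrow> 'v set \<Rightarrow> 'v set \<Rightarrow> ('v \<Rightarrow> 'v \<Rightarrow> 'v) \<Rightarrow> bool" where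
  "star_identity sc P0 P1 m \<longleftrightarrow>
     (\<forall>i<2. \<forall>j<2. \<forall>k<2. \<forall>x\<in>part P0 P1 i. \<forall>y\<in>part P0 P1 j. \<forall>z\<in>part P0 P1 k.
        sc 3 (m (m x y) z) - sc 3 (m x (m y z))
        + sc ((-1) ^ (i * j)) (m (m y x) z)
        - sc ((-1) ^ (j * k)) (m (m x z) y)
        - sc ((-1) ^ (i * j + i * k)) (m (m y z) x)
        + sc ((-1) ^ (i * k + j * k)) (m (m z x) y) = 0)"

text \<open>Bilinear extension of x.y = 1/2 (xy + (-1)^{|x||y|} yx) from homogeneous x,y.\<close>
definition sym_part ::
  "('k::field \<Rightarrow> 'v::ab_group_add \<Rightarrow> 'v) \<Rightarrow> 'v set \<Rightarrow> 'v set \<Rightarrow> ('v \<Rightarrow> 'v \<Rightarrow> 'v) \<Rightarrow> 'v \<Rightarrow> 'v \<Rightarrow> 'v" where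
  "sym_part sc P0 P1 m x y = (\<Sum>i<2. \<Sum>j<2.
     sc (1/2) (m (proj P0 P1 i x) (proj P0 P1 j y)
               + sc ((-1) ^ (i * j)) (m (proj P0 P1 j y) (proj P0 P1 i x))))"

text \<open>Bilinear extension of {x,y} = 1/2 (xy - (-1)^{|x||y|} yx) from homogeneous x,y.\<close>
definition skew_part ::
  "('k::field \<Rightarrow> 'v::ab_group_add \<Rightarrow> 'v) \<Rightarrow> 'v set \<Rightarrow> 'v set \<Rightarrow> ('v \<Rightarrow> 'v \<Rightarrow> 'v) \<Rightarrow> 'v \<Rightarrow> 'v \<Rightarrow> 'v" where
  "skew_part sc P0 P1 m x y = (\<Sum>i<2. \<Sum>j<2.
     sc (1/2) (m (proj P0 P1 i x) (proj P0 P1 j y)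
               - sc ((-1) ^ (i * j)) (m (proj P0 P1 j y) (proj P0 P1 i x))))"

end

theory Submission
  imports Defs
begin

text \<open>
  Up to Koszul signs the argument is linear algebra on the twelve products of three homogeneous
  elements. In a Poisson superalgebra the Leibniz rule writes every \<open>(xy)z\<close> and \<open>x(yz)\<close> through
  \<open>(x \<cdot> y) \<cdot> z\<close>, the three products \<open>{_, _} \<cdot> _\<close> and the three double brackets; in the star identity
  the first four cancel, and the rest cancels by Jacobi. Conversely, the star identity for the six
  permutations of \<open>x, y, z\<close> solves for each \<open>x(yz)\<close> in terms of the six products \<open>(xy)z\<close>, after
  which all Poisson axioms become identities between these six.\<close>

lemma sum_lessThan_2: "(\<Sum>i<2. f i) = f 0 + f (1::nat)"
  for f :: "nat \<Rightarrow> 'a::comm_monoid_add"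
  by (simp add: numeral_2_eq_2)

section \<open>Koszul signs\<close>

abbreviation koszul_sign :: "nat \<Rightarrow> nat \<Rightarrow> 'k::field" where
  "koszul_sign i j \<equiv> (-1) ^ (i * j)"

text \<open>The sign depends only on the parity of the exponent, so reducing the degree of a product
  mod 2 is harmless: moving a product past an element costs the signs of both factors.\<close>

lemma koszul_sign_add_mod2_left:
  "koszul_sign ((i + j) mod 2) k = (koszul_sign i k * koszul_sign j k :: 'k::field)"
  by (auto simp: minus_one_power_iff)

lemma koszul_sign_add_mod2_right:
  "koszul_sign k ((i + j) mod 2) = (koszul_sign k i * koszul_sign k j :: 'k::field)"
  by (auto simp: minus_one_power_iff)

lemma koszul_sign_commute: "koszul_sign j i = koszul_sign i j"
  by (simp add: mult.commute)

text \<open>Allows sign bookkeeping by cases: once the three pairwise signs are fixed to 1 or -1,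
  the identities below become plain linear ones.\<close>

lemma koszul_sign_cases:
  obtains "koszul_sign i j = (1::'k::field)" | "koszul_sign i j = (-1::'k::field)"
  by (cases "even (i * j)") auto

text \<open>Splits the summed exponents, so that only the three pairwise signs of \<open>x\<close>,
  \<open>y\<close>, \<open>z\<close> occur.\<close>

lemma star_identity_alt:
  "star_identity sc P0 P1 m \<longleftrightarrow>
    (\<forall>i<2. \<forall>j<2. \<forall>k<2. \<forall>x\<in>part P0 P1 i. \<forall>y\<in>part P0 P1 j. \<forall>z\<in>part P0 P1 k.
      sc 3 (m (m x y) z) - sc 3 (m x (m y z))
        + sc (koszul_sign i j) (m (m y x) z)
        - sc (koszul_sign j k) (m (m x z) y)
        - sc (koszul_sign i j * koszul_sign i k) (m (m y z) x)
        + sc (koszul_sign i k * koszul_sign j k) (m (m z x) y) = 0)"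
  unfolding star_identity_def power_add ..

section \<open>Graded spaces and homogeneous components\<close>

locale super_space =
  fixes sc :: "'k::field_char_0 \<Rightarrow> 'v::ab_group_add \<Rightarrow> 'v" and P0 P1 :: "'v set"
  assumes super_vs: "super_vs sc P0 P1"
begin

sublocale vector_space sc
  using super_vs by (simp add: super_vs_def)

lemma scale_numeral_2: "sc 2 v = v + v"
  using scale_left_distrib[of 1 1 v] by simp

lemma scale_numeral_3: "sc 3 v = v + v + v"
  using scale_left_distrib[of 2 1 v] by (simp add: scale_numeral_2)

lemma part_add: "x \<in> part P0 P1 i \<Longrightarrow> y \<in> part P0 P1 i \<Longrightarrow> x + y \<in> part P0 P1 i"
  using super_vs by (auto simp: super_vs_def is_subspace_def part_def)

lemma part_scale: "x \<in> part P0 P1 i \<Longrightarrow> sc c x \<in> part P0 P1 i"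
  using super_vs by (auto simp: super_vs_def is_subspace_def part_def)

lemma part_zero: "0 \<in> part P0 P1 i"
  using super_vs by (auto simp: super_vs_def is_subspace_def part_def)

lemma part_minus: "x \<in> part P0 P1 i \<Longrightarrow> - x \<in> part P0 P1 i"
  using part_scale[of x i "-1"] by simp

lemma part_diff: "x \<in> part P0 P1 i \<Longrightarrow> y \<in> part P0 P1 i \<Longrightarrow> x - y \<in> part P0 P1 i"
  using part_add[of x i "- y"] part_minus[of y i] by simp

lemma part_Int: "i < 2 \<Longrightarrow> x \<in> part P0 P1 i \<Longrightarrow> x \<in> part P0 P1 (1 - i) \<Longrightarrow> x = 0"
  using super_vs by (auto simp: super_vs_def part_def less_2_cases_iff split: if_splits)

lemma part_decomp:
  assumes "i < 2"
  shows "\<exists>a. a \<in> part P0 P1 i \<and> v - a \<in> part P0 P1 (1 - i)"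
proof -
  obtain a b where "a \<in> P0" "b \<in> P1" "v = a + b"
    using super_vs unfolding super_vs_def by blast
  then show ?thesis
    using assms by (cases "i = 0") (auto simp: part_def intro: exI[of _ a] exI[of _ b])
qed

text \<open>Uniqueness behind the definite description in \<open>proj\<close>: two candidates differ
  by an element of both parts, hence by 0.\<close>

lemma proj_eqI:
  assumes "i < 2" "a \<in> part P0 P1 i" "v - a \<in> part P0 P1 (1 - i)"
  shows "proj P0 P1 i v = a"
  unfolding proj_def
proof (rule the_equality)
  fix b assume b: "b \<in> part P0 P1 i \<and> v - b \<in> part P0 P1 (1 - i)"
  have "b - a \<in> part P0 P1 i" "(v - a) - (v - b) \<in> part P0 P1 (1 - i)"
    using b assms part_diff by blast+
  then have "b - a = 0" using part_Int[OF assms(1), of "b - a"] by simp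
  then show "b = a" by simp
qed (use assms in simp)

lemma proj_in_part: "i < 2 \<Longrightarrow> proj P0 P1 i v \<in> part P0 P1 i"
  and proj_compl_in_part: "i < 2 \<Longrightarrow> v - proj P0 P1 i v \<in> part P0 P1 (1 - i)"
  using part_decomp proj_eqI by metis+

lemma proj_add: "i < 2 \<Longrightarrow> proj P0 P1 i (v + w) = proj P0 P1 i v + proj P0 P1 i w"
  using part_add[OF proj_compl_in_part proj_compl_in_part, of i v w]
  by (intro proj_eqI part_add proj_in_part) (simp_all add: algebra_simps)

lemma proj_scale: "i < 2 \<Longrightarrow> proj P0 P1 i (sc c v) = sc c (proj P0 P1 i v)"
  using part_scale[OF proj_compl_in_part, of i c v]
  by (intro proj_eqI part_scale proj_in_part) (simp_all add: scale_right_diff_distrib)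

lemma proj_sum: "proj P0 P1 0 v + proj P0 P1 1 v = v"
proof -
  have "proj P0 P1 1 v = v - proj P0 P1 0 v"
    using proj_in_part[of 0 v] proj_compl_in_part[of 0 v] by (intro proj_eqI) auto
  then show ?thesis by simp
qed

lemma proj_homogeneous:
  assumes "i < 2" "j < 2" "x \<in> part P0 P1 i"
  shows "proj P0 P1 j x = (if j = i then x else 0)"
proof (cases "j = i")
  case False
  then have "i = 1 - j" using assms(1,2) by auto
  then show ?thesis using assms False by (simp add: proj_eqI part_zero)
qed (use assms in \<open>simp add: proj_eqI part_zero\<close>)

end

section \<open>Even bilinear products and their polarizations\<close>

locale super_algebra = super_space +
  fixes m :: "'b \<Rightarrow> 'b \<Rightarrow> 'b"
  assumes bilinear: "bilinear_prod sc m" and even: "even_prod P0 P1 m"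
begin

lemma add_left: "m (x + y) z = m x z + m y z"
  and add_right: "m x (y + z) = m x y + m x z"
  and mult_scale_left: "m (sc c x) y = sc c (m x y)"
  and mult_scale_right: "m x (sc c y) = sc c (m x y)"
  using bilinear by (simp_all add: bilinear_prod_def)

lemma zero_left: "m 0 y = 0" and zero_right: "m x 0 = 0"
  using mult_scale_left[of 0 0 y] mult_scale_right[of x 0 0] by simp_all

lemma minus_left: "m (- x) y = - m x y" and minus_right: "m x (- y) = - m x y"
  using mult_scale_left[of "-1" x y] mult_scale_right[of x "-1" y] by simp_all

lemma in_part:
  "i < 2 \<Longrightarrow> j < 2 \<Longrightarrow> x \<in> part P0 P1 i \<Longrightarrow> y \<in> part P0 P1 j \<Longrightarrow>
    m x y \<in> part P0 P1 ((i + j) mod 2)"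
  using even by (simp add: even_prod_def)

lemmas bilinear_simps = add_left add_right mult_scale_left mult_scale_right
  zero_left zero_right minus_left minus_right

text \<open>Both polarizations at once: \<open>s = 1\<close> gives the symmetric and \<open>s = -1\<close> the skew part.\<close>
definition polarize :: "'a \<Rightarrow> 'b \<Rightarrow> 'b \<Rightarrow> 'b" where
  "polarize s x y = (\<Sum>i<2. \<Sum>j<2.
     sc (1/2) (m (proj P0 P1 i x) (proj P0 P1 j y)
               + sc (s * koszul_sign i j) (m (proj P0 P1 j y) (proj P0 P1 i x))))"

lemma sym_part_eq_polarize: "sym_part sc P0 P1 m = polarize 1"
  by (simp add: fun_eq_iff sym_part_def polarize_def)

lemma skew_part_eq_polarize: "skew_part sc P0 P1 m = polarize (-1)"
  by (simp add: fun_eq_iff skew_part_def polarize_def)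

text \<open>Of the four summands only the one at the degrees of \<open>x\<close> and
  \<open>y\<close> can be nonzero, which recovers the formula that is being extended
  bilinearly.\<close>

lemma polarize_homogeneous:
  assumes "i < 2" "j < 2" "x \<in> part P0 P1 i" "y \<in> part P0 P1 j"
  shows "polarize s x y = sc (1/2) (m x y + sc (s * koszul_sign i j) (m y x))"
  using assms(1,2)
  by (auto simp: polarize_def sum_lessThan_2 proj_homogeneous[OF assms(1) _ assms(3)]
      proj_homogeneous[OF assms(2) _ assms(4)] zero_left zero_right less_2_cases_iff)

lemma polarize_in_part:
  assumes "i < 2" "j < 2" "x \<in> part P0 P1 i" "y \<in> part P0 P1 j"
  shows "polarize s x y \<in> part P0 P1 ((i + j) mod 2)"
  using in_part[OF assms] in_part[OF assms(2,1,4,3)]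
  by (simp add: polarize_homogeneous[OF assms] part_scale part_add add.commute)

lemma bilinear_polarize: "bilinear_prod sc (polarize s)"
  unfolding bilinear_prod_def polarize_def sum_lessThan_2
  by (simp add: proj_add proj_scale bilinear_simps scale_right_distrib
      scale_right_diff_distrib scale_left_commute algebra_simps)

lemma even_polarize: "even_prod P0 P1 (polarize s)"
  unfolding even_prod_def using polarize_in_part by blast

text \<open>For each pair of degrees the sign terms of the two polarizations cancel; what remains is
  \<open>m\<close> expanded over homogeneous components.\<close>

lemma polarize_sum: "polarize 1 x y + polarize (-1) x y = m x y"
proof -
  have half: "sc (1/2) (a + b) + sc (1/2) (a - b) = a" for a b
    by (simp add: scale_numeral_2[symmetric] flip: scale_right_distrib)
  have "polarize 1 x y + polarize (-1) x y =
      (\<Sum>i<2. \<Sum>j<2. m (proj P0 P1 i x) (proj P0 P1 j y))"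
    unfolding polarize_def sum.distrib[symmetric]
    by (intro sum.cong refl) (simp add: half)
  also have "\<dots> = m (proj P0 P1 0 x + proj P0 P1 1 x) (proj P0 P1 0 y + proj P0 P1 1 y)"
    by (simp only: sum_lessThan_2 add_left add_right add_ac)
  finally show ?thesis by (simp only: proj_sum)
qed

text \<open>Swapping \<open>x\<close> and \<open>y\<close> exchanges the two terms up to the factor
  \<open>s * koszul_sign i j\<close>, which is its own inverse because
  \<open>s * s = 1\<close>.\<close>

lemma polarize_commute:
  assumes "i < 2" "j < 2" "x \<in> part P0 P1 i" "y \<in> part P0 P1 j" "s * s = 1"
  shows "polarize s x y = sc (s * koszul_sign i j) (polarize s y x)"
proof (cases rule: koszul_sign_cases[of i j, where ?'k = 'a])
qed (use assms(5) in \<open>simp_all add: polarize_homogeneous[OF assms(1-4)]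
  polarize_homogeneous[OF assms(2,1,4,3)] koszul_sign_commute[of j i]
  scale_right_distrib scale_right_diff_distrib\<close>)

text \<open>The factor 4 clears the two halves. The inner product has degree
  \<open>(i + j) mod 2\<close>, so its sign against \<open>z\<close> is the product of the signs of
  \<open>x\<close> and \<open>y\<close> against \<open>z\<close>.\<close>

lemma polarize_polarize_left:
  assumes "i < 2" "j < 2" "k < 2" "x \<in> part P0 P1 i" "y \<in> part P0 P1 j" "z \<in> part P0 P1 k"
  shows "sc 4 (polarize t (polarize s x y) z) =
    m (m x y) z + sc s (sc (koszul_sign i j) (m (m y x) z))
    + sc t (sc (koszul_sign i k * koszul_sign j k) (m z (m x y)))
    + sc (s * t) (sc (koszul_sign i j * koszul_sign i k * koszul_sign j k) (m z (m y x)))"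
proof -
  have "(i + j) mod 2 < 2" by simp
  note h = polarize_homogeneous[OF this assms(3) polarize_in_part[OF assms(1,2,4,5)] assms(6)]
  show ?thesis
    unfolding h unfolding koszul_sign_add_mod2_left polarize_homogeneous[OF assms(1,2,4,5)]
    by (simp add: bilinear_simps scale_right_distrib add_ac mult_ac)
qed

lemma polarize_polarize_right:
  assumes "i < 2" "j < 2" "k < 2" "x \<in> part P0 P1 i" "y \<in> part P0 P1 j" "z \<in> part P0 P1 k"
  shows "sc 4 (polarize t x (polarize s y z)) =
    m x (m y z) + sc s (sc (koszul_sign j k) (m x (m z y)))
    + sc t (sc (koszul_sign i j * koszul_sign i k) (m (m y z) x))
    + sc (s * t) (sc (koszul_sign i j * koszul_sign i k * koszul_sign j k) (m (m z y) x))"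
proof -
  have "(j + k) mod 2 < 2" by simp
  note h = polarize_homogeneous[OF assms(1) this assms(4) polarize_in_part[OF assms(2,3,5,6)]]
  show ?thesis
    unfolding h unfolding koszul_sign_add_mod2_right polarize_homogeneous[OF assms(2,3,5,6)]
    by (simp add: bilinear_simps scale_right_distrib add_ac mult_ac)
qed

end

section \<open>From the star identity to the Poisson axioms\<close>

text \<open>
  For \<open>x\<close>, \<open>y\<close>, \<open>z\<close> homogeneous, \<open>a1\<close>, \<dots>, \<open>a6\<close> stand for the products \<open>(xy)z\<close>, \<open>(yx)z\<close>, \<open>(xz)y\<close>,
  \<open>(yz)x\<close>, \<open>(zx)y\<close>, \<open>(zy)x\<close> and \<open>b1\<close>, \<dots>, \<open>b6\<close> for \<open>x(yz)\<close>, \<open>y(xz)\<close>, \<open>x(zy)\<close>, \<open>y(zx)\<close>, \<open>z(xy)\<close>,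
  \<open>z(yx)\<close>, each multiplied by the Koszul sign of its permutation of \<open>x, y, z\<close>.\<close>
lemma (in super_space) star_consequences:
  assumes "sc 3 a1 - sc 3 b1 + a2 - a3 - a4 + a5 = 0"
    and "sc 3 a2 - sc 3 b2 + a1 - a4 - a3 + a6 = 0"
    and "sc 3 a3 - sc 3 b3 + a5 - a1 - a6 + a2 = 0"
    and "sc 3 a4 - sc 3 b4 + a6 - a2 - a5 + a1 = 0"
    and "sc 3 a5 - sc 3 b5 + a3 - a6 - a1 + a4 = 0"
    and "sc 3 a6 - sc 3 b6 + a4 - a5 - a2 + a3 = 0"
  shows star_assoc: "a1 + a2 + b5 + b6 = b1 + b3 + a4 + a6"
    and star_Jacobi: "(b1 - b3 - a4 + a6) + (b4 - b2 - a5 + a3) + (b5 - b6 - a1 + a2) = 0"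
    and star_Leibniz: "b1 + b3 - a4 - a6 = (a1 - a2 + b5 - b6) + (b2 - b4 + a3 - a5)"
proof -
  \<comment> \<open>Each hypothesis contains exactly one \<open>b\<close>, with coefficient 3, and
    therefore determines it.\<close>
  have solve: "b = sc (1/3) (sc 3 a + u)" if "sc 3 a - sc 3 b + u = 0" for a b u
  proof -
    have "sc 3 b = sc 3 a + u" using that by (simp add: algebra_simps)
    then have "sc (1/3) (sc 3 b) = sc (1/3) (sc 3 a + u)" by simp
    then show ?thesis by simp
  qed
  \<comment> \<open>In terms of these thirds all twelve quantities are integer combinations, so the
    three claims reduce to identities in an abelian group.\<close>
  define c1 c2 c3 c4 c5 c6 where
    "c1 = sc (1/3) a1" and "c2 = sc (1/3) a2" and "c3 = sc (1/3) a3" and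
    "c4 = sc (1/3) a4" and "c5 = sc (1/3) a5" and "c6 = sc (1/3) a6"
  have a: "a1 = c1 + c1 + c1" "a2 = c2 + c2 + c2" "a3 = c3 + c3 + c3"
    "a4 = c4 + c4 + c4" "a5 = c5 + c5 + c5" "a6 = c6 + c6 + c6"
    by (simp_all add: c1_def c2_def c3_def c4_def c5_def c6_def flip: scale_numeral_3)
  have "b1 = sc (1/3) (sc 3 a1 + (a2 - a3 - a4 + a5))"
    "b2 = sc (1/3) (sc 3 a2 + (a1 - a4 - a3 + a6))"
    "b3 = sc (1/3) (sc 3 a3 + (a5 - a1 - a6 + a2))"
    "b4 = sc (1/3) (sc 3 a4 + (a6 - a2 - a5 + a1))"
    "b5 = sc (1/3) (sc 3 a5 + (a3 - a6 - a1 + a4))"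
    "b6 = sc (1/3) (sc 3 a6 + (a4 - a5 - a2 + a3))"
    using assms by (auto intro!: solve simp: algebra_simps)
  then have b: "b1 = a1 + c2 - c3 - c4 + c5" "b2 = a2 + c1 - c4 - c3 + c6"
    "b3 = a3 + c5 - c1 - c6 + c2" "b4 = a4 + c6 - c2 - c5 + c1"
    "b5 = a5 + c3 - c6 - c1 + c4" "b6 = a6 + c4 - c5 - c2 + c3"
    by (simp_all add: scale_right_distrib scale_right_diff_distrib add_diff_eq add.assoc
        c1_def c2_def c3_def c4_def c5_def c6_def)
  show "a1 + a2 + b5 + b6 = b1 + b3 + a4 + a6"
    "(b1 - b3 - a4 + a6) + (b4 - b2 - a5 + a3) + (b5 - b6 - a1 + a2) = 0"
    "b1 + b3 - a4 - a6 = (a1 - a2 + b5 - b6) + (b2 - b4 + a3 - a5)"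
    unfolding b unfolding a by (simp_all add: algebra_simps)
qed

context super_algebra
begin

text \<open>Four times each term of an axiom, up to a sign, is a sum of signed triple products; the
  axioms are then \<open>star_assoc\<close>, \<open>star_Jacobi\<close> and
  \<open>star_Leibniz\<close>.\<close>

lemma star_polarize:
  assumes star: "star_identity sc P0 P1 m"
    and ijk: "i < 2" "j < 2" "k < 2"
    and xyz: "x \<in> part P0 P1 i" "y \<in> part P0 P1 j" "z \<in> part P0 P1 k"
  defines "dot \<equiv> polarize 1" and "br \<equiv> polarize (-1)"
  shows "dot (dot x y) z = dot x (dot y z)" (is ?assoc)
    and "sc (koszul_sign k i) (br x (br y z)) + sc (koszul_sign i j) (br y (br z x))
          + sc (koszul_sign j k) (br z (br x y)) = 0" (is ?Jacobi)
    and "br x (dot y z) = dot (br x y) z + sc (koszul_sign i j) (dot y (br x z))" (is ?Leibniz)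
proof -
  define p q r :: 'a where
    "p = koszul_sign i j" and "q = koszul_sign j k" and "r = koszul_sign i k"
  have signs: "koszul_sign i j = p" "koszul_sign j i = p" "koszul_sign j k = q"
    "koszul_sign k j = q" "koszul_sign i k = r" "koszul_sign k i = r"
    by (simp_all add: p_def q_def r_def koszul_sign_commute)
  have pqr: "p = 1 \<or> p = -1" "q = 1 \<or> q = -1" "r = 1 \<or> r = -1"
    unfolding p_def q_def r_def by (metis koszul_sign_cases)+
  note S = star[unfolded star_identity_alt, rule_format]
  \<comment> \<open>The permutations xyz, yxz, xzy, yzx, zxy, zyx, in the order of the hypotheses of
    \<open>star_consequences\<close>.\<close>
  note stars = S[OF ijk xyz] S[OF ijk(2,1,3) xyz(2,1,3)] S[OF ijk(1,3,2) xyz(1,3,2)]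
    S[OF ijk(2,3,1) xyz(2,3,1)] S[OF ijk(3,1,2) xyz(3,1,2)] S[OF ijk(3,2,1) xyz(3,2,1)]
  note L = polarize_polarize_left[OF ijk xyz] and R = polarize_polarize_right[OF ijk xyz]
    polarize_polarize_right[OF ijk(2,3,1) xyz(2,3,1)]
    polarize_polarize_right[OF ijk(3,1,2) xyz(3,1,2)]
    polarize_polarize_right[OF ijk(2,1,3) xyz(2,1,3)]
  \<comment> \<open>One factor \<open>p\<close>, \<open>q\<close> or \<open>r\<close> enters for
    each pair among \<open>x\<close>, \<open>y\<close>, \<open>z\<close> whose order is
    reversed.\<close>
  define a1 a2 a3 a4 a5 a6 where
    "a1 = m (m x y) z" and "a2 = sc p (m (m y x) z)" and "a3 = sc q (m (m x z) y)" and
    "a4 = sc (p * r) (m (m y z) x)" and "a5 = sc (q * r) (m (m z x) y)" and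
    "a6 = sc (p * q * r) (m (m z y) x)"
  define b1 b2 b3 b4 b5 b6 where
    "b1 = m x (m y z)" and "b2 = sc p (m y (m x z))" and "b3 = sc q (m x (m z y))" and
    "b4 = sc (p * r) (m y (m z x))" and "b5 = sc (q * r) (m z (m x y))" and
    "b6 = sc (p * q * r) (m z (m y x))"
  note defs = a1_def a2_def a3_def a4_def a5_def a6_def b1_def b2_def b3_def b4_def b5_def b6_def
  have scaled_star: "sc c v = 0" if "v = 0" for c v
    using that by simp
  \<comment> \<open>Each permuted star identity is multiplied by the sign of its permutation; since
    signs square to 1, its terms become exactly the signed products.\<close>
  have H: "sc 3 a1 - sc 3 b1 + a2 - a3 - a4 + a5 = 0"
    "sc 3 a2 - sc 3 b2 + a1 - a4 - a3 + a6 = 0"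
    "sc 3 a3 - sc 3 b3 + a5 - a1 - a6 + a2 = 0"
    "sc 3 a4 - sc 3 b4 + a6 - a2 - a5 + a1 = 0"
    "sc 3 a5 - sc 3 b5 + a3 - a6 - a1 + a4 = 0"
    "sc 3 a6 - sc 3 b6 + a4 - a5 - a2 + a3 = 0"
    subgoal unfolding signs defs using pqr
      by (intro trans[OF _ scaled_star[OF stars(1), of "1"]]; elim disjE)
        (simp_all add: signs algebra_simps)
    subgoal unfolding signs defs using pqr
      by (intro trans[OF _ scaled_star[OF stars(2), of "p"]]; elim disjE)
        (simp_all add: signs algebra_simps)
    subgoal unfolding signs defs using pqr
      by (intro trans[OF _ scaled_star[OF stars(3), of "q"]]; elim disjE)
        (simp_all add: signs algebra_simps)
    subgoal unfolding signs defs using pqr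
      by (intro trans[OF _ scaled_star[OF stars(4), of "p * r"]]; elim disjE)
        (simp_all add: signs algebra_simps)
    subgoal unfolding signs defs using pqr
      by (intro trans[OF _ scaled_star[OF stars(5), of "q * r"]]; elim disjE)
        (simp_all add: signs algebra_simps)
    subgoal unfolding signs defs using pqr
      by (intro trans[OF _ scaled_star[OF stars(6), of "p * q * r"]]; elim disjE)
        (simp_all add: signs algebra_simps)
    done
  have cancel: "u = v" if "sc 4 u = sc 4 v" for u v
    using that by simp
  note LR = L[unfolded signs] R[unfolded signs]
  have "sc 4 (dot (dot x y) z) = a1 + a2 + b5 + b6"
    unfolding dot_def LR defs by (simp add: mult_ac)
  moreover have "sc 4 (dot x (dot y z)) = b1 + b3 + a4 + a6"
    unfolding dot_def LR defs by (simp add: mult_ac)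
  ultimately have "sc 4 (dot (dot x y) z) = sc 4 (dot x (dot y z))"
    using star_assoc[OF H] by (simp only:)
  then show ?assoc by (rule cancel)
  have "sc 4 (br x (br y z)) = b1 - b3 - a4 + a6"
    unfolding br_def LR defs by (simp add: mult_ac)
  moreover have "sc 4 (sc (p * r) (br y (br z x))) = b4 - b2 - a5 + a3"
    unfolding br_def defs using pqr by (elim disjE) (simp_all add: LR)
  moreover have "sc 4 (sc (q * r) (br z (br x y))) = b5 - b6 - a1 + a2"
    unfolding br_def defs using pqr by (elim disjE) (simp_all add: LR)
  ultimately have "sc 4 (br x (br y z) + sc (p * r) (br y (br z x)) + sc (q * r) (br z (br x y)))
      = sc 4 0"
    using star_Jacobi[OF H] by (simp only: scale_right_distrib scale_zero_right)
  then have J: "br x (br y z) + sc (p * r) (br y (br z x)) + sc (q * r) (br z (br x y)) = 0"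
    by (rule cancel)
  \<comment> \<open>The Jacobi expression with its prescribed signs is \<open>r\<close> times the
    cyclic sum with permutation signs, because \<open>r * r = 1\<close>.\<close>
  have "sc r (br x (br y z)) + sc p (br y (br z x)) + sc q (br z (br x y))
      = sc r (br x (br y z) + sc (p * r) (br y (br z x)) + sc (q * r) (br z (br x y)))"
    using pqr(3) by (elim disjE) (simp_all add: algebra_simps)
  then show ?Jacobi
    unfolding signs J by simp
  have "sc 4 (br x (dot y z)) = b1 + b3 - a4 - a6"
    unfolding br_def dot_def LR defs by (simp add: mult_ac)
  moreover have "sc 4 (dot (br x y) z) = a1 - a2 + b5 - b6"
    unfolding br_def dot_def LR defs by (simp add: mult_ac)
  moreover have "sc 4 (sc p (dot y (br x z))) = b2 - b4 + a3 - a5"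
    unfolding br_def dot_def defs using pqr by (elim disjE) (simp_all add: LR)
  ultimately have "sc 4 (br x (dot y z)) = sc 4 (dot (br x y) z + sc p (dot y (br x z)))"
    using star_Leibniz[OF H] by (simp only: scale_right_distrib)
  then show ?Leibniz unfolding signs by (rule cancel)
qed

lemma poisson_polarize:
  assumes "star_identity sc P0 P1 m"
  shows "poisson_superalgebra sc P0 P1 (polarize 1) (polarize (-1))"
  unfolding poisson_superalgebra_def
proof (intro conjI allI impI ballI bilinear_polarize even_polarize)
  fix i j k :: nat and x y z
  assume ijk: "i < 2" "j < 2" "k < 2"
    and xyz: "x \<in> part P0 P1 i" "y \<in> part P0 P1 j" "z \<in> part P0 P1 k"
  show "polarize 1 x y = sc (koszul_sign i j) (polarize 1 y x)"
    "polarize (-1) x y = - sc (koszul_sign i j) (polarize (-1) y x)"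
    using polarize_commute[OF ijk(1,2) xyz(1,2), of 1] polarize_commute[OF ijk(1,2) xyz(1,2), of "-1"]
    by simp_all
qed (rule star_polarize[OF assms]; assumption)+

end

section \<open>From a Poisson superalgebra to the star identity\<close>

locale poisson_superalgebra_space = super_space +
  fixes dot br :: "'b \<Rightarrow> 'b \<Rightarrow> 'b"
  assumes poisson: "poisson_superalgebra sc P0 P1 dot br"
begin

sublocale dot: super_algebra sc P0 P1 dot
  using poisson by unfold_locales (simp_all add: poisson_superalgebra_def)

sublocale br: super_algebra sc P0 P1 br
  using poisson by unfold_locales (simp_all add: poisson_superalgebra_def)

lemma bilinear_sum: "bilinear_prod sc (\<lambda>x y. dot x y + br x y)"
  by (simp add: bilinear_prod_def dot.bilinear_simps br.bilinear_simps scale_right_distrib add_ac)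

lemma even_sum: "even_prod P0 P1 (\<lambda>x y. dot x y + br x y)"
  unfolding even_prod_def using dot.in_part br.in_part part_add by blast

lemma
  assumes "i < 2" "j < 2" "x \<in> part P0 P1 i" "y \<in> part P0 P1 j"
  shows dot_commute: "dot x y = sc (koszul_sign i j) (dot y x)"
    and br_commute: "br x y = - sc (koszul_sign i j) (br y x)"
  using poisson assms unfolding poisson_superalgebra_def by blast+

lemma
  assumes "i < 2" "j < 2" "k < 2" "x \<in> part P0 P1 i" "y \<in> part P0 P1 j" "z \<in> part P0 P1 k"
  shows dot_assoc: "dot (dot x y) z = dot x (dot y z)"
    and Jacobi: "sc (koszul_sign k i) (br x (br y z)) + sc (koszul_sign i j) (br y (br z x))
          + sc (koszul_sign j k) (br z (br x y)) = 0"
    and Leibniz: "br x (dot y z) = dot (br x y) z + sc (koszul_sign i j) (dot y (br x z))"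
  using poisson assms unfolding poisson_superalgebra_def by blast+

text \<open>Passing \<open>x\<close> across a product of degree \<open>(j + k) mod 2\<close>
  collects its signs against \<open>y\<close> and \<open>z\<close>. This turns every nested product
  into one with the inner product on the left.\<close>

lemma commute_product:
  assumes "i < 2" "j < 2" "k < 2" "x \<in> part P0 P1 i" "y \<in> part P0 P1 j" "z \<in> part P0 P1 k"
  shows "dot x (dot y z) = sc (koszul_sign i j * koszul_sign i k) (dot (dot y z) x)"
    and "dot x (br y z) = sc (koszul_sign i j * koszul_sign i k) (dot (br y z) x)"
    and "br x (dot y z) = - sc (koszul_sign i j * koszul_sign i k) (br (dot y z) x)"
    and "br x (br y z) = - sc (koszul_sign i j * koszul_sign i k) (br (br y z) x)"
proof -
  have "(j + k) mod 2 < 2" by simp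
  note c = dot_commute[OF assms(1) this assms(4)] br_commute[OF assms(1) this assms(4)]
  show "dot x (dot y z) = sc (koszul_sign i j * koszul_sign i k) (dot (dot y z) x)"
    "br x (dot y z) = - sc (koszul_sign i j * koszul_sign i k) (br (dot y z) x)"
    using c[OF dot.in_part[OF assms(2,3,5,6)]] by (simp_all only: koszul_sign_add_mod2_right)
  show "dot x (br y z) = sc (koszul_sign i j * koszul_sign i k) (dot (br y z) x)"
    "br x (br y z) = - sc (koszul_sign i j * koszul_sign i k) (br (br y z) x)"
    using c[OF br.in_part[OF assms(2,3,5,6)]] by (simp_all only: koszul_sign_add_mod2_right)
qed

text \<open>Normal forms for both bracketings. Their first four terms agree, so the associator of
  the sum product consists of double brackets only.\<close>

lemma
  assumes ijk: "i < 2" "j < 2" "k < 2"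
    and xyz: "x \<in> part P0 P1 i" "y \<in> part P0 P1 j" "z \<in> part P0 P1 k"
  defines "p \<equiv> koszul_sign i j" and "q \<equiv> koszul_sign j k" and "r \<equiv> koszul_sign i k"
  shows left_product: "dot (dot x y + br x y) z + br (dot x y + br x y) z =
      dot (dot x y) z + dot (br x y) z + sc (p * r) (dot (br y z) x) - sc (q * r) (dot (br z x) y)
        + br (br x y) z" (is ?left)
    and right_product: "dot x (dot y z + br y z) + br x (dot y z + br y z) =
      dot (dot x y) z + dot (br x y) z + sc (p * r) (dot (br y z) x) - sc (q * r) (dot (br z x) y)
        - sc (p * r) (br (br y z) x)" (is ?right)
proof -
  have signs: "koszul_sign i j = p" "koszul_sign j i = p" "koszul_sign j k = q"
    "koszul_sign k j = q" "koszul_sign i k = r" "koszul_sign k i = r"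
    by (simp_all add: p_def q_def r_def koszul_sign_commute)
  have pqr: "p = 1 \<or> p = -1" "q = 1 \<or> q = -1" "r = 1 \<or> r = -1"
    unfolding p_def q_def r_def by (metis koszul_sign_cases)+
  note flip = br_commute[OF ijk(3,1) xyz(3,1), unfolded signs]
    br_commute[OF ijk(3,2) xyz(3,2), unfolded signs]
  note c_xyz = commute_product[OF ijk xyz, unfolded signs]
    and c_yxz = commute_product(2)[OF ijk(2,1,3) xyz(2,1,3), unfolded signs]
    and c_zxy = commute_product(3)[OF ijk(3,1,2) xyz(3,1,2), unfolded signs]
  note L_xyz = Leibniz[OF ijk xyz, unfolded signs]
    and L_zxy = Leibniz[OF ijk(3,1,2) xyz(3,1,2), unfolded signs]
  \<comment> \<open>The Leibniz rule acts on the second argument only, so the bracket is turned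
    around before expanding.\<close>
  have "br (dot x y) z = - sc (q * r) (br z (dot x y))"
    unfolding c_zxy using pqr by (elim disjE) simp_all
  also have "\<dots> = sc (p * r) (dot (br y z) x) - sc (q * r) (dot (br z x) y)"
    unfolding L_zxy flip(2) dot.bilinear_simps c_xyz(2)
    using pqr by (elim disjE) (simp_all add: algebra_simps)
  finally show ?left
    by (simp add: dot.add_left br.add_left algebra_simps)
  \<comment> \<open>Brings the second Leibniz term of \<open>br x (dot y z)\<close> to the normal
    form with \<open>br z x\<close>.\<close>
  have "sc p (dot y (br x z)) = - sc (q * r) (dot (br z x) y)"
    unfolding c_yxz flip(1) dot.bilinear_simps using pqr by (elim disjE) simp_all
  then show ?right
    by (simp add: dot.add_right br.add_right L_xyz c_xyz(2,4) dot_assoc[OF ijk xyz] algebra_simps)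
qed

text \<open>Let B1, B2, B3 be the double brackets \<open>br (br x y) z\<close>,
  \<open>br (br y z) x\<close>, \<open>br (br z x) y\<close> with their permutation signs. The two
  terms with coefficient 3 give 3 B1 + 3 B2, the other four give - B1 - B2 + 2 B3, and all terms
  containing \<open>dot\<close> cancel. The total is twice the Jacobi sum B1 + B2 + B3.\<close>

lemma star_sum: "star_identity sc P0 P1 (\<lambda>x y. dot x y + br x y)"
  unfolding star_identity_alt
proof (intro allI impI ballI)
  fix i j k :: nat and x y z
  assume ijk: "i < 2" "j < 2" "k < 2"
    and xyz: "x \<in> part P0 P1 i" "y \<in> part P0 P1 j" "z \<in> part P0 P1 k"
  define p q r :: 'a where
    "p = koszul_sign i j" and "q = koszul_sign j k" and "r = koszul_sign i k"
  have signs: "koszul_sign i j = p" "koszul_sign j i = p" "koszul_sign j k = q"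
    "koszul_sign k j = q" "koszul_sign i k = r" "koszul_sign k i = r"
    by (simp_all add: p_def q_def r_def koszul_sign_commute)
  have pqr: "p = 1 \<or> p = -1" "q = 1 \<or> q = -1" "r = 1 \<or> r = -1"
    unfolding p_def q_def r_def by (metis koszul_sign_cases)+
  \<comment> \<open>All inner brackets are oriented cyclically as xy, yz, zx, leaving one
    representative for each.\<close>
  have flip: "br y x = - sc p (br x y)" "br x z = - sc r (br z x)" "br z y = - sc q (br y z)"
    "dot y x = sc p (dot x y)" "dot x z = sc r (dot z x)"
    using br_commute[OF ijk(2,1) xyz(2,1)] br_commute[OF ijk(1,3) xyz(1,3)]
      br_commute[OF ijk(3,2) xyz(3,2)] dot_commute[OF ijk(2,1) xyz(2,1)]
      dot_commute[OF ijk(1,3) xyz(1,3)]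
    by (simp_all only: signs)
  \<comment> \<open>By associativity and supercommutativity all triple \<open>dot\<close> products
    agree up to the sign of the permutation.\<close>
  have cycle: "dot (dot y z) x = sc (p * r) (dot (dot x y) z)"
    "dot (dot z x) y = sc (q * r) (dot (dot x y) z)"
    unfolding dot_assoc[OF ijk xyz] dot_assoc[OF ijk(3,1,2) xyz(3,1,2)]
    subgoal using pqr unfolding commute_product(1)[OF ijk xyz] signs
      by (elim disjE) simp_all
    subgoal using pqr unfolding commute_product(1)[OF ijk(3,1,2) xyz(3,1,2)] signs
        dot_assoc[OF ijk xyz, symmetric]
      by (elim disjE) simp_all
    done
  \<comment> \<open>Turning the outer brackets around and factoring out \<open>- sc r\<close>
    converts permutation signs into those of the Jacobi axiom.\<close>
  have "br (br x y) z + sc (p * r) (br (br y z) x) + sc (q * r) (br (br z x) y)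
      = - sc r (sc r (br x (br y z)) + sc p (br y (br z x)) + sc q (br z (br x y)))"
    unfolding commute_product(4)[OF ijk xyz] commute_product(4)[OF ijk(2,3,1) xyz(2,3,1)]
      commute_product(4)[OF ijk(3,1,2) xyz(3,1,2)] signs
    using pqr by (elim disjE) (simp_all add: algebra_simps)
  also have "\<dots> = 0"
    using Jacobi[OF ijk xyz] unfolding signs by simp
  finally have J: "br (br x y) z = - sc (p * r) (br (br y z) x) - sc (q * r) (br (br z x) y)"
    by (simp add: algebra_simps eq_neg_iff_add_eq_0)
  show "sc 3 (dot (dot x y + br x y) z + br (dot x y + br x y) z)
      - sc 3 (dot x (dot y z + br y z) + br x (dot y z + br y z))
      + sc (koszul_sign i j) (dot (dot y x + br y x) z + br (dot y x + br y x) z)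
      - sc (koszul_sign j k) (dot (dot x z + br x z) y + br (dot x z + br x z) y)
      - sc (koszul_sign i j * koszul_sign i k) (dot (dot y z + br y z) x + br (dot y z + br y z) x)
      + sc (koszul_sign i k * koszul_sign j k) (dot (dot z x + br z x) y + br (dot z x + br z x) y)
      = 0"
    unfolding left_product[OF ijk xyz] right_product[OF ijk xyz]
      left_product[OF ijk(2,1,3) xyz(2,1,3)] left_product[OF ijk(1,3,2) xyz(1,3,2)]
      left_product[OF ijk(2,3,1) xyz(2,3,1)] left_product[OF ijk(3,1,2) xyz(3,1,2)]
    unfolding signs flip dot.bilinear_simps br.bilinear_simps cycle
    using pqr by (elim disjE) (simp_all add: J scale_numeral_3 algebra_simps)
qed

end

section \<open>Both directions and the equivalence of structures\<close>

theorem mainTheorem1: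
  fixes sc :: "'k::field_char_0 \<Rightarrow> 'v::ab_group_add \<Rightarrow> 'v"
    and P0 P1 :: "'v set"
  assumes "super_vs sc P0 P1"
  shows "(\<forall>dot br. poisson_superalgebra sc P0 P1 dot br \<longrightarrow>
            star_identity sc P0 P1 (\<lambda>x y. dot x y + br x y))
       \<and> (\<forall>m. bilinear_prod sc m \<and> even_prod P0 P1 m \<and> star_identity sc P0 P1 m \<longrightarrow>
            poisson_superalgebra sc P0 P1 (sym_part sc P0 P1 m) (skew_part sc P0 P1 m)
            \<and> (\<forall>x y. m x y = sym_part sc P0 P1 m x y + skew_part sc P0 P1 m x y))
       \<and> ((\<exists>dot br. poisson_superalgebra sc P0 P1 dot br) \<longleftrightarrow>
          (\<exists>m. bilinear_prod sc m \<and> even_prod P0 P1 m \<and> star_identity sc P0 P1 m))"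
proof -
  interpret super_space sc P0 P1 by unfold_locales (rule assms)
  have to_star: "star_identity sc P0 P1 (\<lambda>x y. dot x y + br x y)"
    "bilinear_prod sc (\<lambda>x y. dot x y + br x y)" "even_prod P0 P1 (\<lambda>x y. dot x y + br x y)"
    if "poisson_superalgebra sc P0 P1 dot br" for dot br
  proof -
    interpret poisson_superalgebra_space sc P0 P1 dot br by unfold_locales (rule that)
    show "star_identity sc P0 P1 (\<lambda>x y. dot x y + br x y)"
      "bilinear_prod sc (\<lambda>x y. dot x y + br x y)" "even_prod P0 P1 (\<lambda>x y. dot x y + br x y)"
      by (rule star_sum bilinear_sum even_sum)+
  qed
  have from_star: "poisson_superalgebra sc P0 P1 (sym_part sc P0 P1 m) (skew_part sc P0 P1 m)"
    "m x y = sym_part sc P0 P1 m x y + skew_part sc P0 P1 m x y"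
    if "bilinear_prod sc m" "even_prod P0 P1 m" "star_identity sc P0 P1 m" for m x y
  proof -
    interpret super_algebra sc P0 P1 m by unfold_locales (rule that)+
    show "poisson_superalgebra sc P0 P1 (sym_part sc P0 P1 m) (skew_part sc P0 P1 m)"
      unfolding sym_part_eq_polarize skew_part_eq_polarize
      using that(3) by (rule poisson_polarize)
    show "m x y = sym_part sc P0 P1 m x y + skew_part sc P0 P1 m x y"
      by (simp add: sym_part_eq_polarize skew_part_eq_polarize polarize_sum)
  qed
  show ?thesis
  proof (intro conjI allI impI iffI; (elim conjE exE)?)
    show "\<exists>m. bilinear_prod sc m \<and> even_prod P0 P1 m \<and> star_identity sc P0 P1 m"
      if "poisson_superalgebra sc P0 P1 dot br" for dot br
      by (intro exI[of _ "\<lambda>x y. dot x y + br x y"] conjI to_star that)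
    show "\<exists>dot br. poisson_superalgebra sc P0 P1 dot br"
      if "bilinear_prod sc m" "even_prod P0 P1 m" "star_identity sc P0 P1 m" for m
      using from_star(1)[OF that] by blast
  qed (rule to_star from_star; assumption)+
qed

end
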